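(* Let $g\ge3$, $t$ and $n$ be integers with $1\le t\le 2$ and $t\le n-g$, and let $G\in\mathcal U_{n,g}^{(t)}$. Write $n=q^2+r$ with integers $q\ge1$ and $1\le r\le 2q+1$. Then $q\le b(G)\le q+1$.
   Context: All graphs are finite and simple. Burning number: at time $0$ all vertices of $G$ are unburned. In each round $t\ge1$, one new unburned vertex is chosen to burn (if such a vertex exists), and every unburned neighbour of a vertex that was burned by the end of the previous round becomes burned; burned vertices stay burned. The process ends when all vertices are burned. $b(G)$ is the smallest $k$ such that $G$ can be completely burned within $k$ rounds by a suitable choice of vertices. For $a_1\ge a_2\ge\cdots\ge a_t\ge1$, $U_g^{a_1,\ldots,a_t}$ is the unicyclic graph obtained from a cycle $C_g=v_1v_2\cdots v_gv_1$ by attaching $t$ paths of lengths $a_1,\dots,a_t$ at the vertex $v_g$; that is, the $i$-th attached path contributes $a_i$ new vertices, one end of it being adjacent to $v_g$. Its order is $g+\sum_{i=1}^t a_i$. $\mathcal U_{n,g}^{(t)}$ denotes the set of all graphs $U_g^{a_1,\ldots,a_t}$ with $n=g+\sum_{i=1}^t a_i$. *)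

theory Defs
  imports "Graph_Theory.Graph_Theory"
begin

text \<open>
  Finite simple graphs are the \<^locale>\<open>graph\<close> locale of the library: finite, loop-free
  digraphs without parallel arcs and with a symmetric adjacency relation.
\<close>

section \<open>Graph burning\<close>

text \<open>
  \<open>B k\<close> is the set of vertices burned by the end of round \<open>k\<close>, and \<open>C\<close> is the choice made in
  round \<open>k + 1\<close>.  The chosen vertex has to be unburned at the end of round \<open>k\<close>, but it may be
  adjacent to \<open>B k\<close>.  Once everything is burned, the sequence stays constant.
\<close>

definition burning_process :: "('a, 'b) pre_digraph \<Rightarrow> (nat \<Rightarrow> 'a set) \<Rightarrow> bool" where
  "burning_process G B \<longleftrightarrow>
     B 0 = {} \<and>
     (\<forall>k. \<exists>C. (if verts G - B k = {} then C = {} else (\<exists>x \<in> verts G - B k. C = {x})) \<and>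
        B (Suc k) = B k \<union> C \<union> {w \<in> verts G. \<exists>u \<in> B k. u \<rightarrow>\<^bsub>G\<^esub> w})"

definition burning_number :: "('a, 'b) pre_digraph \<Rightarrow> nat" where
  "burning_number G = (LEAST k. \<exists>B. burning_process G B \<and> B k = verts G)"

text \<open>
  On a finite graph the \<open>LEAST\<close> above ranges over a nonempty set.
\<close>

lemma burning_process_exists:
  fixes G :: "('a, 'b) pre_digraph"
  shows "\<exists>B. burning_process G B"
proof -
  define step :: "'a set \<Rightarrow> 'a set" where "step A = A \<union> (if verts G - A = {} then {} else {SOME x. x \<in> verts G - A})
      \<union> {w \<in> verts G. \<exists>u \<in> A. u \<rightarrow>\<^bsub>G\<^esub> w}" for A
  define B where "B k = (step ^^ k) {}" for k
  have "burning_process G B"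
    unfolding burning_process_def
  proof (intro conjI allI)
    show "B 0 = {}" by (simp add: B_def)
    fix k
    let ?C = "if verts G - B k = {} then {} else {SOME x. x \<in> verts G - B k}"
    have "B (Suc k) = B k \<union> ?C \<union> {w \<in> verts G. \<exists>u \<in> B k. u \<rightarrow>\<^bsub>G\<^esub> w}"
      by (simp add: B_def step_def)
    moreover have "if verts G - B k = {} then ?C = {} else (\<exists>x \<in> verts G - B k. ?C = {x})"
      using some_in_eq[of "verts G - B k"] by auto
    ultimately show "\<exists>C. (if verts G - B k = {} then C = {} else (\<exists>x \<in> verts G - B k. C = {x})) \<and>
        B (Suc k) = B k \<union> C \<union> {w \<in> verts G. \<exists>u \<in> B k. u \<rightarrow>\<^bsub>G\<^esub> w}"
      by blast
  qed
  then show ?thesis by (rule exI[of _ B])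
qed

lemma burning_process_completes:
  assumes fin: "finite (verts G)" and B: "burning_process G B"
  shows "B (card (verts G)) = verts G"
proof -
  have sub: "B k \<subseteq> verts G" for k
  proof (induction k)
    case 0
    show ?case using B by (simp add: burning_process_def)
  next
    case (Suc k)
    obtain C where "if verts G - B k = {} then C = {} else (\<exists>x \<in> verts G - B k. C = {x})"
      and "B (Suc k) = B k \<union> C \<union> {w \<in> verts G. \<exists>u \<in> B k. u \<rightarrow>\<^bsub>G\<^esub> w}"
      using B unfolding burning_process_def by blast
    then show ?case using Suc by (auto split: if_splits)
  qed
  have "B k = verts G \<or> k \<le> card (B k)" for k
  proof (induction k)
    case (Suc k)
    obtain C where C: "if verts G - B k = {} then C = {} else (\<exists>x \<in> verts G - B k. C = {x})"
      and BS: "B (Suc k) = B k \<union> C \<union> {w \<in> verts G. \<exists>u \<in> B k. u \<rightarrow>\<^bsub>G\<^esub> w}"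
      using B unfolding burning_process_def by blast
    show ?case
    proof (cases "B k = verts G")
      case True
      then show ?thesis using BS sub[of "Suc k"] by auto
    next
      case False
      then obtain x where "x \<notin> B k" "x \<in> B (Suc k)" "B k \<subseteq> B (Suc k)"
        using C BS sub[of k] by (auto split: if_splits)
      then have "B k \<subset> B (Suc k)" by blast
      then have "card (B k) < card (B (Suc k))"
        using finite_subset[OF sub fin] by (intro psubset_card_mono) auto
      then show ?thesis using Suc False by auto
    qed
  qed simp
  from this[of "card (verts G)"] show ?thesis
    using card_seteq[OF fin sub] by auto
qed

section \<open>Cycles with attached paths\<close>

text \<open>
  \<open>Cyc i\<close>, for \<open>1 \<le> i \<le> g\<close>, is the cycle vertex $v_i$.  \<open>Leg i j\<close>, for \<open>1 \<le> j \<le> as ! i\<close>, is the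
  \<open>j\<close>-th vertex, counted from the cycle, of the path with index \<open>i\<close> (starting from 0).
\<close>

datatype uvertex = Cyc nat | Leg nat nat

definition cycle_with_paths :: "nat \<Rightarrow> nat list \<Rightarrow> uvertex pair_pre_digraph" where
  "cycle_with_paths g as =
     (let E = {(Cyc i, Cyc (Suc i)) | i. 1 \<le> i \<and> i < g} \<union> {(Cyc g, Cyc 1)}
            \<union> {(Cyc g, Leg i 1) | i. i < length as}
            \<union> {(Leg i j, Leg i (Suc j)) | i j. i < length as \<and> 1 \<le> j \<and> j < as ! i}
      in \<lparr> pverts = {Cyc i | i. 1 \<le> i \<and> i \<le> g} \<union>
                     {Leg i j | i j. i < length as \<and> 1 \<le> j \<and> j \<le> as ! i},
           parcs = E \<union> E\<inverse> \<rparr>)"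

text \<open>
  The class $\mathcal{U}_{n,g}^{(t)}$, closed under isomorphism, over arbitrary vertex and arc types.
\<close>

definition unicyclic_class :: "nat \<Rightarrow> nat \<Rightarrow> nat \<Rightarrow> ('a, 'b) pre_digraph set" where
  "unicyclic_class n g t =
     {G. graph G \<and>
         (\<exists>as. length as = t \<and> sorted_wrt (\<ge>) as \<and> (\<forall>a \<in> set as. a \<ge> 1) \<and>
               n = g + sum_list as \<and>
               digraph_iso (with_proj (cycle_with_paths g as)) G)}"

lemma card_cycle_with_paths: "card (pverts (cycle_with_paths g as)) = g + sum_list as"
proof -
  let ?L = "SIGMA i:{..<length as}. {1..as ! i}"
  have eq: "pverts (cycle_with_paths g as) = Cyc ` {1..g} \<union> case_prod Leg ` ?L"
    by (auto simp: cycle_with_paths_def Let_def image_iff)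
  have "card (case_prod Leg ` ?L) = card ?L"
    by (intro card_image) (auto simp: inj_on_def)
  also have "\<dots> = sum_list as"
    by (simp add: sum_list_sum_nth atLeast0LessThan)
  finally have "card (case_prod Leg ` ?L) = sum_list as" .
  moreover have "card (Cyc ` {1..g}) = g"
    by (subst card_image) (auto simp: inj_on_def)
  moreover have "card (Cyc ` {1..g} \<union> case_prod Leg ` ?L)
      = card (Cyc ` {1..g}) + card (case_prod Leg ` ?L)"
    by (intro card_Un_disjoint) auto
  ultimately show ?thesis using eq by simp
qed

lemma pair_graph_cycle_with_paths:
  assumes "g \<ge> 3" and "\<forall>a \<in> set as. a \<ge> 1"
  shows "pair_graph (cycle_with_paths g as)"
proof -
  let ?G = "cycle_with_paths g as"
  have pos: "Suc 0 \<le> as ! i" if "i < length as" for i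
    using assms(2) that by (metis One_nat_def nth_mem)
  have wf: "parcs ?G \<subseteq> pverts ?G \<times> pverts ?G"
    using assms(1) by (auto simp: cycle_with_paths_def Let_def pos)
  have "card (pverts ?G) > 0"
    using assms(1) by (simp add: card_cycle_with_paths)
  then have fin: "finite (pverts ?G)"
    using card_ge_0_finite by blast
  have "finite (parcs ?G)"
    using finite_subset[OF wf] fin by simp
  moreover have "symmetric (with_proj ?G)"
    by (auto simp: symmetric_def sym_def cycle_with_paths_def Let_def)
  moreover have "fst e \<noteq> snd e" if "e \<in> parcs ?G" for e
    using that assms(1) by (auto simp: cycle_with_paths_def Let_def)
  ultimately show ?thesis
    using wf fin by unfold_locales auto
qed

end

theory Submission
  imports Defs
begin

text \<open>
  A graph burns within \<open>m\<close> rounds iff balls of radii \<open>0, 1, \<dots>, m - 1\<close> around suitable vertices cover it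
  (\<open>burning_number_le_iff\<close>): a source chosen in round \<open>m - k\<close> has \<open>k\<close> rounds left to spread.  On a
  path these balls have at most \<open>1 + 3 + \<dots> + (2 * m - 1) = m ^ 2\<close> vertices, so the burning number of a
  path is the square root of the order, rounded up.  A cycle with at most two attached paths is close
  enough to a path to deviate from this by at most one.

  For the upper bound, delete a cycle edge at the junction.  What remains is a spanning spider with
  at most three legs, and such a spider with at most \<open>m ^ 2\<close> vertices burns within \<open>m\<close> rounds
  (\<open>spider_cover_three_legs\<close>).  The largest ball either cuts \<open>2 * m - 1\<close> vertices off a long leg, or,
  if all legs are short, sits at the centre and leaves three pieces that are easily covered, up to
  some small cases.  As the order is at most \<open>(q + 1) ^ 2\<close>, this gives \<open>q + 1\<close> rounds.

  For the lower bound, a ball exceeds the \<open>2 * k + 1\<close> vertices that it would have on a path only by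
  spreading through the junction, from the cycle into the paths or the other way round.  Only the
  ball that reaches farthest beyond the junction gains vertices in this way, since it contains what
  the others could gain; hence \<open>b\<close> rounds burn at most \<open>b ^ 2 + 2 * b\<close> vertices
  (\<open>card_covered_cycle_with_paths_le\<close>).  For \<open>b = q - 1\<close> this is less than \<open>q ^ 2\<close>.
\<close>

section \<open>Burning as covering by balls\<close>

definition graph_ball :: "('a, 'b) pre_digraph \<Rightarrow> nat \<Rightarrow> 'a \<Rightarrow> 'a set" where
  "graph_ball G k x = {y. \<exists>j\<le>k. (x, y) \<in> arcs_ends G ^^ j}"

lemma graph_ballI: "(x, y) \<in> arcs_ends G ^^ j \<Longrightarrow> j \<le> k \<Longrightarrow> y \<in> graph_ball G k x"
  by (auto simp: graph_ball_def)

lemma graph_ball_self: "x \<in> graph_ball G k x"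
  by (rule graph_ballI[where j = 0]) auto

lemma graph_ball_mono: "k \<le> l \<Longrightarrow> graph_ball G k x \<subseteq> graph_ball G l x"
  unfolding graph_ball_def using le_trans by blast

lemma graph_ball_trans:
  assumes "y \<in> graph_ball G k x" and "z \<in> graph_ball G l y"
  shows "z \<in> graph_ball G (k + l) x"
proof -
  obtain i j where "i \<le> k" "(x, y) \<in> arcs_ends G ^^ i" "j \<le> l" "(y, z) \<in> arcs_ends G ^^ j"
    using assms by (auto simp: graph_ball_def)
  then show ?thesis
    by (intro graph_ballI[where j = "i + j"]) (auto simp: relpow_add)
qed

lemma graph_ball_adj: "x \<rightarrow>\<^bsub>G\<^esub> y \<Longrightarrow> y \<in> graph_ball G 1 x"
  by (rule graph_ballI[where j = 1]) auto

lemma burning_process_Suc: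
  assumes "burning_process G B"
  obtains C where "if verts G - B k = {} then C = {} else (\<exists>x \<in> verts G - B k. C = {x})"
    and "B (Suc k) = B k \<union> C \<union> {w \<in> verts G. \<exists>u \<in> B k. u \<rightarrow>\<^bsub>G\<^esub> w}"
  using assms unfolding burning_process_def by blast

lemma burning_process_subset_verts:
  assumes "burning_process G B"
  shows "B k \<subseteq> verts G"
proof (induction k)
  case 0
  show ?case using assms by (simp add: burning_process_def)
next
  case (Suc k)
  obtain C where "if verts G - B k = {} then C = {} else (\<exists>x \<in> verts G - B k. C = {x})"
    and "B (Suc k) = B k \<union> C \<union> {w \<in> verts G. \<exists>u \<in> B k. u \<rightarrow>\<^bsub>G\<^esub> w}"
    using burning_process_Suc[OF assms] .
  then show ?case using Suc by (auto split: if_splits)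
qed

lemma burning_process_mono:
  assumes "burning_process G B" and "k \<le> l"
  shows "B k \<subseteq> B l"
  using assms(2)
proof (induction rule: dec_induct)
  case (step l)
  then show ?case using burning_process_Suc[OF assms(1), of l] by blast
qed simp

lemma (in wf_digraph) burning_process_ball:
  assumes B: "burning_process G B" and x: "x \<in> B i"
  shows "graph_ball G j x \<subseteq> B (i + j)"
proof -
  have "y \<in> B (i + l)" if "(x, y) \<in> arcs_ends G ^^ l" for y l
    using that
  proof (induction l arbitrary: y)
    case 0
    then show ?case using x by simp
  next
    case (Suc l)
    then obtain z where "z \<in> B (i + l)" "z \<rightarrow>\<^bsub>G\<^esub> y" by auto
    then show ?case
      using burning_process_Suc[OF B, of "i + l"] adj_in_verts(2) by auto
  qed
  then show ?thesis
    using burning_process_mono[OF B, of "i + l" "i + j" for l] by (fastforce simp: graph_ball_def)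
qed

text \<open>
  The vertex chosen in round \<open>i + 1\<close> has burned its ball of radius \<open>k - 1 - i\<close> by the end of round
  \<open>k\<close>, and every fire goes back to a chosen vertex.  When nothing is left to choose, \<open>v0\<close> serves as
  a dummy source.
\<close>

lemma burning_process_covered:
  assumes B: "burning_process G B" and v0: "v0 \<in> verts G"
  obtains x where "\<And>k. x k \<in> verts G" and "\<And>k. B k \<subseteq> (\<Union>i<k. graph_ball G (k - 1 - i) (x i))"
proof -
  have ex: "\<exists>x. x \<in> verts G \<and> B (Suc k) \<subseteq> insert x (B k) \<union> {w. \<exists>u \<in> B k. u \<rightarrow>\<^bsub>G\<^esub> w}" for k
  proof -
    obtain C where C: "if verts G - B k = {} then C = {} else (\<exists>x \<in> verts G - B k. C = {x})"
      and "B (Suc k) = B k \<union> C \<union> {w \<in> verts G. \<exists>u \<in> B k. u \<rightarrow>\<^bsub>G\<^esub> w}"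
      using burning_process_Suc[OF B] .
    moreover have "\<exists>x \<in> verts G. C \<subseteq> {x}"
      using C v0 by (cases "verts G - B k = {}") auto
    ultimately show ?thesis by blast
  qed
  have "\<forall>k. \<exists>x. x \<in> verts G \<and> B (Suc k) \<subseteq> insert x (B k) \<union> {w. \<exists>u \<in> B k. u \<rightarrow>\<^bsub>G\<^esub> w}"
    using ex by blast
  from choice[OF this] obtain x where x_step: "\<forall>k. x k \<in> verts G \<and>
      B (Suc k) \<subseteq> insert (x k) (B k) \<union> {w. \<exists>u \<in> B k. u \<rightarrow>\<^bsub>G\<^esub> w}" ..
  have x: "x k \<in> verts G"
    and step: "B (Suc k) \<subseteq> insert (x k) (B k) \<union> {w. \<exists>u \<in> B k. u \<rightarrow>\<^bsub>G\<^esub> w}" for k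
    using x_step[rule_format, of k] by (rule conjunct1, rule conjunct2)
  have "\<exists>i<k. w \<in> graph_ball G (k - 1 - i) (x i)" if "w \<in> B k" for w k
    using that
  proof (induction k arbitrary: w)
    case 0
    then show ?case using B by (simp add: burning_process_def)
  next
    case (Suc k)
    consider "w = x k" | "w \<in> B k" | u where "u \<in> B k" "u \<rightarrow>\<^bsub>G\<^esub> w"
      using step[of k] Suc.prems by blast
    then show ?case
    proof cases
      case 1
      then show ?thesis by (intro exI[of _ k]) (simp add: graph_ball_self)
    next
      case 2
      then obtain i where i: "i < k" "w \<in> graph_ball G (k - 1 - i) (x i)" using Suc.IH by blast
      have "graph_ball G (k - 1 - i) (x i) \<subseteq> graph_ball G (k - i) (x i)"
        by (rule graph_ball_mono) simp
      then show ?thesis using i by (intro exI[of _ i]) auto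
    next
      case 3
      then obtain i where i: "i < k" "u \<in> graph_ball G (k - 1 - i) (x i)" using Suc.IH by blast
      have "w \<in> graph_ball G (k - 1 - i + 1) (x i)"
        using graph_ball_trans[OF i(2) graph_ball_adj[OF 3(2)]] .
      moreover have "k - 1 - i + 1 = k - i" using i(1) by simp
      ultimately show ?thesis using i(1) by (intro exI[of _ i]) auto
    qed
  qed
  then have "B k \<subseteq> (\<Union>i<k. graph_ball G (k - 1 - i) (x i))" for k by blast
  with x show ?thesis by (rule that)
qed

lemma burning_number_complete:
  assumes "finite (verts G)"
  obtains B where "burning_process G B" and "B (burning_number G) = verts G"
proof -
  have "\<exists>k B. burning_process G B \<and> B k = verts G"
    using burning_process_exists[of G] burning_process_completes[OF assms] by blast
  then have "\<exists>B. burning_process G B \<and> B (burning_number G) = verts G"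
    unfolding burning_number_def by (rule LeastI_ex)
  then show ?thesis using that by blast
qed

text \<open>
  This turns burning into a static covering problem: the source chosen in round \<open>m - k\<close> has \<open>k\<close>
  rounds left to spread.  Conversely, prescribed centres can be used as sources, because a centre
  that burns before its turn has spread at least as far as it would have from its own round on.
\<close>

lemma (in fin_digraph) burning_number_le_iff:
  assumes nonempty: "verts G \<noteq> {}"
  shows "burning_number G \<le> m \<longleftrightarrow>
    (\<exists>c. (\<forall>k<m. c k \<in> verts G) \<and> verts G \<subseteq> (\<Union>k<m. graph_ball G k (c k)))"
proof
  assume le: "burning_number G \<le> m"
  obtain B where B: "burning_process G B" and b: "B (burning_number G) = verts G"
    using burning_number_complete[OF finite_verts] .
  obtain v0 where v0: "v0 \<in> verts G" using nonempty by blast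
  obtain x where x: "\<And>k. x k \<in> verts G"
    and cov: "\<And>k. B k \<subseteq> (\<Union>i<k. graph_ball G (k - 1 - i) (x i))"
    using burning_process_covered[OF B v0] by blast
  have "verts G \<subseteq> (\<Union>i<m. graph_ball G (m - 1 - i) (x i))"
    using burning_process_mono[OF B le] b cov[of m] by blast
  also have "\<dots> \<subseteq> (\<Union>k<m. graph_ball G k (x (m - 1 - k)))"
  proof
    fix w assume "w \<in> (\<Union>i<m. graph_ball G (m - 1 - i) (x i))"
    then obtain i where "i < m" "w \<in> graph_ball G (m - 1 - i) (x i)" by blast
    then show "w \<in> (\<Union>k<m. graph_ball G k (x (m - 1 - k)))"
      by (intro UN_I[of "m - 1 - i"]) auto
  qed
  finally show "\<exists>c. (\<forall>k<m. c k \<in> verts G) \<and> verts G \<subseteq> (\<Union>k<m. graph_ball G k (c k))"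
    using x by (intro exI[of _ "\<lambda>k. x (m - 1 - k)"]) auto
next
  assume "\<exists>c. (\<forall>k<m. c k \<in> verts G) \<and> verts G \<subseteq> (\<Union>k<m. graph_ball G k (c k))"
  then obtain c where c: "\<And>k. k < m \<Longrightarrow> c k \<in> verts G"
    and cov: "verts G \<subseteq> (\<Union>k<m. graph_ball G k (c k))" by blast
  \<comment> \<open>A prescribed source that is already burned is replaced by an arbitrary unburned vertex.\<close>
  define choice where "choice x A =
    (if x \<in> verts G - A then {x} else if verts G - A = {} then {}
     else {SOME y. y \<in> verts G - A})" for x A
  define B where "B = rec_nat {}
    (\<lambda>k A. A \<union> choice (c (m - 1 - k)) A \<union> {w \<in> verts G. \<exists>u \<in> A. u \<rightarrow>\<^bsub>G\<^esub> w})"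
  have B_Suc: "B (Suc k) = B k \<union> choice (c (m - 1 - k)) (B k)
      \<union> {w \<in> verts G. \<exists>u \<in> B k. u \<rightarrow>\<^bsub>G\<^esub> w}" for k
    by (simp add: B_def)
  have choice: "if verts G - A = {} then choice x A = {} else (\<exists>y \<in> verts G - A. choice x A = {y})"
    for x A
    using some_in_eq[of "verts G - A"] by (auto simp: choice_def)
  have B: "burning_process G B"
    unfolding burning_process_def
  proof (intro conjI allI)
    show "B 0 = {}" by (simp add: B_def)
    show "\<exists>C. (if verts G - B k = {} then C = {} else (\<exists>x \<in> verts G - B k. C = {x})) \<and>
        B (Suc k) = B k \<union> C \<union> {w \<in> verts G. \<exists>u \<in> B k. u \<rightarrow>\<^bsub>G\<^esub> w}" for k
      using choice B_Suc by blast
  qed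
  have "graph_ball G k (c k) \<subseteq> B m" if k: "k < m" for k
  proof -
    have eq: "m - 1 - (m - 1 - k) = k" "Suc (m - 1 - k) + k = m" using k by auto
    have "c k \<in> B (Suc (m - 1 - k))"
      using c[OF k] unfolding B_Suc eq by (auto simp: choice_def)
    from burning_process_ball[OF B this, of k] show ?thesis by (simp only: eq)
  qed
  then have "B m = verts G"
    using cov burning_process_subset_verts[OF B, of m] by blast
  then show "burning_number G \<le> m"
    unfolding burning_number_def using B by (intro Least_le) blast
qed

text \<open>
  A homomorphism maps balls into balls of the same radius, so a surjective one carries coverings
  over.  Applied in both directions, this gives invariance under isomorphism.
\<close>

lemma burning_number_surj_hom_le:
  assumes "fin_digraph G" and "fin_digraph H" and nonempty: "verts H \<noteq> {}"
    and surj: "f ` verts H = verts G"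
    and hom: "\<And>u v. u \<rightarrow>\<^bsub>H\<^esub> v \<Longrightarrow> f u \<rightarrow>\<^bsub>G\<^esub> f v"
  shows "burning_number G \<le> burning_number H"
proof -
  interpret G: fin_digraph G by fact
  interpret H: fin_digraph H by fact
  have "(f u, f v) \<in> arcs_ends G ^^ j" if "(u, v) \<in> arcs_ends H ^^ j" for u v j
    using that by (induction j arbitrary: v) (auto intro: hom)
  then have ball: "f ` graph_ball H k x \<subseteq> graph_ball G k (f x)" for k x
    by (auto simp: graph_ball_def)
  obtain c where c: "\<forall>k<burning_number H. c k \<in> verts H"
    and cov: "verts H \<subseteq> (\<Union>k<burning_number H. graph_ball H k (c k))"
    using H.burning_number_le_iff[OF nonempty, of "burning_number H"] by auto
  have "f ` verts H \<subseteq> (\<Union>k<burning_number H. graph_ball G k (f (c k)))"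
    using image_mono[OF cov, of f] ball unfolding image_UN by blast
  then have "verts G \<subseteq> (\<Union>k<burning_number H. graph_ball G k (f (c k)))"
    by (simp only: surj)
  moreover have "\<forall>k<burning_number H. f (c k) \<in> verts G"
    using c surj by blast
  moreover have "verts G \<noteq> {}" using nonempty surj by blast
  ultimately show ?thesis
    by (subst G.burning_number_le_iff) (auto intro!: exI[of _ "\<lambda>k. f (c k)"])
qed

lemma burning_number_iso:
  assumes "fin_digraph H" and "verts H \<noteq> {}" and "digraph_iso H G"
  shows "burning_number G = burning_number H"
proof -
  interpret H: fin_digraph H by fact
  obtain f where f: "H.digraph_isomorphism f" and G: "G = app_iso f H"
    using assms(3) by (auto simp: digraph_iso_def)
  interpret G: fin_digraph G unfolding G using f by (rule H.fin_digraphI_app_iso)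
  have arcs: "arcs_ends G = map_prod (iso_verts f) (iso_verts f) ` arcs_ends H"
    using f by (auto simp: arcs_ends_conv G H.iso_verts_tail H.iso_verts_head image_image
        intro!: image_cong)
  have "burning_number G \<le> burning_number H"
  proof (rule burning_number_surj_hom_le[where f = "iso_verts f"])
    show "iso_verts f ` verts H = verts G" by (simp add: G)
  qed (use assms(1,2) G.fin_digraph_axioms in \<open>auto simp: arcs\<close>)
  moreover have "burning_number H \<le> burning_number G"
  proof (rule burning_number_surj_hom_le[where f = "iso_verts (H.inv_iso f)"])
    show "iso_verts (H.inv_iso f) ` verts G = verts H"
      using f by (auto simp: G image_image)
    show "iso_verts (H.inv_iso f) u \<rightarrow>\<^bsub>H\<^esub> iso_verts (H.inv_iso f) v" if "u \<rightarrow>\<^bsub>G\<^esub> v" for u v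
    proof -
      obtain x y where xy: "x \<rightarrow>\<^bsub>H\<^esub> y" "u = iso_verts f x" "v = iso_verts f y"
        using \<open>u \<rightarrow>\<^bsub>G\<^esub> v\<close> by (auto simp: arcs)
      then show ?thesis
        using f H.adj_in_verts[OF xy(1)] by (simp add: H.iso_verts_inv_iso)
    qed
  qed (use assms G.fin_digraph_axioms in \<open>auto simp: G\<close>)
  ultimately show ?thesis by simp
qed

section \<open>Covering spiders with three legs\<close>

text \<open>
  The pair \<open>(i, p)\<close> is the vertex of leg \<open>i\<close> at distance \<open>p\<close> from the centre; all pairs \<open>(i, 0)\<close>
  stand for the centre.  Legs are infinite here, so a ball may be centred beyond the part that has
  to be covered.
\<close>

definition spider_dist :: "nat \<times> nat \<Rightarrow> nat \<times> nat \<Rightarrow> nat" where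
  "spider_dist p q =
     (if fst p = fst q then nat \<bar>int (snd p) - int (snd q)\<bar> else snd p + snd q)"

definition spider_cover :: "nat set \<Rightarrow> (nat \<times> nat) set \<Rightarrow> bool" where
  "spider_cover K S \<longleftrightarrow> (\<exists>c. \<forall>p\<in>S. \<exists>k\<in>K. spider_dist (c k) p \<le> k)"

definition leg_segment :: "nat \<Rightarrow> nat \<Rightarrow> nat \<Rightarrow> (nat \<times> nat) set" where
  "leg_segment i a b = {i} \<times> {a..b}"

lemma spider_cover_single: "(\<And>p. p \<in> S \<Longrightarrow> spider_dist c p \<le> k) \<Longrightarrow> spider_cover {k} S"
  unfolding spider_cover_def by (rule exI[of _ "\<lambda>_. c"]) auto

lemma spider_cover_mono: "spider_cover K S \<Longrightarrow> K \<subseteq> L \<Longrightarrow> T \<subseteq> S \<Longrightarrow> spider_cover L T"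
  unfolding spider_cover_def by (meson subsetD)

lemma spider_cover_Un:
  assumes "spider_cover K S" and "spider_cover L T" and "K \<inter> L = {}"
  shows "spider_cover (K \<union> L) (S \<union> T)"
proof -
  obtain c d where c: "\<forall>p\<in>S. \<exists>k\<in>K. spider_dist (c k) p \<le> k"
    and d: "\<forall>p\<in>T. \<exists>k\<in>L. spider_dist (d k) p \<le> k"
    using assms(1,2) unfolding spider_cover_def by blast
  have "k \<notin> K" if "k \<in> L" for k using assms(3) that by blast
  then show ?thesis
    unfolding spider_cover_def
    using c d by (intro exI[of _ "\<lambda>k. if k \<in> K then c k else d k"]) (metis Un_iff)
qed

lemma spider_cover_combine:
  assumes "spider_cover K S" and "spider_cover L T" and "K \<inter> L = {}"
    and "K \<union> L \<subseteq> M" and "R \<subseteq> S \<union> T"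
  shows "spider_cover M R"
  using spider_cover_mono[OF spider_cover_Un] assms by blast

lemma spider_cover_segment: "b \<le> a + 2 * k \<Longrightarrow> spider_cover {k} (leg_segment i a b)"
  by (rule spider_cover_single[of _ "(i, a + k)"]) (auto simp: spider_dist_def leg_segment_def)

lemma spider_cover_centre: "spider_cover {k} (leg_segment i 0 k \<union> leg_segment j 0 k \<union> leg_segment l 0 k)"
  by (rule spider_cover_single[of _ "(i, 0)"]) (auto simp: spider_dist_def leg_segment_def)

text \<open>
  The balls of radii \<open>0, \<dots>, m - 1\<close> on a path have \<open>1 + 3 + \<dots> + (2 * m - 1) = m ^ 2\<close> vertices in all, so
  they tile it, the largest ball first.
\<close>

lemma spider_cover_segment_square: "b < a + m ^ 2 \<Longrightarrow> spider_cover {..<m} (leg_segment i a b)"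
proof (induction m arbitrary: a)
  case 0
  then show ?case by (simp add: leg_segment_def spider_cover_def)
next
  case (Suc m)
  have "spider_cover {m} (leg_segment i a (a + 2 * m))"
    by (rule spider_cover_segment) simp
  moreover have "spider_cover {..<m} (leg_segment i (a + 2 * m + 1) b)"
    using Suc.prems by (intro Suc.IH) (simp add: power2_eq_square)
  ultimately show ?case
    by (rule spider_cover_combine) (auto simp: leg_segment_def)
qed

text \<open>
  Two legs form a path.  Its largest ball swallows the whole of the first leg, so that what remains
  lies in the second leg and can be tiled.
\<close>

lemma spider_cover_two_legs:
  assumes "i \<noteq> j" and "x \<le> 2 * m" and "x + y + 1 \<le> (Suc m) ^ 2"
  shows "spider_cover {..<Suc m} (leg_segment i 0 x \<union> leg_segment j 0 y)"
proof -
  have "spider_cover {m} (leg_segment i 0 x \<union> leg_segment j 0 (2 * m - x))"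
    using assms(1,2)
    by (intro spider_cover_single[of _ "if x \<le> m then (j, m - x) else (i, x - m)"])
      (auto simp: spider_dist_def leg_segment_def)
  moreover have "spider_cover {..<m} (leg_segment j (2 * m - x + 1) y)"
    using assms by (intro spider_cover_segment_square) (auto simp: power2_eq_square)
  ultimately show ?thesis
    by (rule spider_cover_combine) (auto simp: leg_segment_def)
qed

text \<open>
  If no leg is longer than \<open>2 * m\<close>, the ball of radius \<open>m\<close> around the centre leaves at most \<open>m\<close>
  vertices on each leg, and the balls of radii \<open>m - 1\<close>, \<open>m - 2\<close>, \<open>m - 3\<close> cover one remainder each as
  soon as \<open>m \<ge> 5\<close>.  For smaller \<open>m\<close> the bound on the order makes the remainders shorter.  Then only
  two spiders resist: three legs of length 8, where the last remainder takes two balls, and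
  three legs of length 5, where the largest ball has to move off the centre.  A leg of length 0 is
  excluded because of the legs 4, 4, 0: there the ball of radius 2 around the centre leaves two
  remainders of length 2 for intervals of lengths 3 and 1.
\<close>

lemma spider_cover_short_legs:
  assumes ij: "i \<noteq> j" and ik: "i \<noteq> k" and jk: "j \<noteq> k"
    and x: "x \<le> 2 * m" and y: "y \<le> x" and z: "z \<le> y" and z1: "1 \<le> z"
    and sum: "x + y + z + 1 \<le> (Suc m) ^ 2"
  shows "spider_cover {..<Suc m} (leg_segment i 0 x \<union> leg_segment j 0 y \<union> leg_segment k 0 z)"
proof -
  have centre: "spider_cover {m} (leg_segment i 0 m \<union> leg_segment j 0 m \<union> leg_segment k 0 m)"
    by (rule spider_cover_centre)
  have m1: "1 \<le> m" using x y z z1 by auto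
  have X: "spider_cover {m - 1} (leg_segment i (m + 1) x)"
    using x m1 by (intro spider_cover_segment) auto
  have combine: ?thesis
    if "spider_cover L (leg_segment j (m + 1) y)" and "spider_cover M (leg_segment k (m + 1) z)"
      and "L \<inter> M = {}" and "L \<subseteq> {..<m - 1}" and "M \<subseteq> {..<m - 1}" for L M
    by (rule spider_cover_combine[OF centre
          spider_cover_Un[OF X spider_cover_Un[OF that(1-3)]]])
      (use m1 that(4,5) in \<open>auto simp: leg_segment_def\<close>)
  have seg_empty: "spider_cover {} (leg_segment l (m + 1) w)" if "w \<le> m" for l w
    using that by (simp add: leg_segment_def spider_cover_def)
  show ?thesis
  proof (cases "z \<le> m")
    case zm: True
    show ?thesis
    proof (cases "y \<le> m")
      case True
      show ?thesis by (rule combine[OF seg_empty seg_empty]) (use True zm in auto)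
    next
      case False
      have m2: "2 \<le> m"
      proof (rule ccontr)
        assume "\<not> 2 \<le> m"
        then have "m = 1" using m1 by auto
        then show False using False y sum z1 by (auto simp: power2_eq_square)
      qed
      have "y \<le> m + 1 + 2 * (m - 2)"
      proof (cases "m = 2")
        case True
        then show ?thesis using sum y z1 by (simp add: power2_eq_square)
      qed (use m2 x y in auto)
      then have "spider_cover {m - 2} (leg_segment j (m + 1) y)"
        by (rule spider_cover_segment)
      from combine[OF this seg_empty] zm m2 show ?thesis by auto
    qed
  next
    case zm: False
    have "m \<noteq> 1" "m \<noteq> 2" using sum y z zm by (auto simp: power2_eq_square)
    then have m3: "3 \<le> m" using m1 by auto
    have Y: "spider_cover {m - 2} (leg_segment j (m + 1) y)"
      using x y m3 by (intro spider_cover_segment) auto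
    show ?thesis
    proof (cases "z \<le> m + 1 + 2 * (m - 3)")
      case True
      then have "spider_cover {m - 3} (leg_segment k (m + 1) z)"
        by (rule spider_cover_segment)
      from combine[OF Y this] m3 show ?thesis by auto
    next
      case False
      then have "m \<le> 4" using x y z by auto
      then consider "m = 3" | "m = 4" using m3 by linarith
      then show ?thesis
      proof cases
        case 1
        then have xyz: "x = 5" "y = 5" "z = 5"
          using False y z sum by (auto simp: power2_eq_square)
        \<comment> \<open>Around the centre, radius 3 would leave three remainders of length 2 for intervals of
          lengths 5, 3 and 1.  One step into leg \<open>i\<close>, it leaves lengths 1, 3 and 3.\<close>
        have c: "spider_cover {3} (leg_segment i 0 4 \<union> leg_segment j 0 2 \<union> leg_segment k 0 2)"
          by (rule spider_cover_single[of _ "(i, 1)"])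
            (auto simp: spider_dist_def leg_segment_def ij ik)
        have i: "spider_cover {0} (leg_segment i 5 5)" by (rule spider_cover_segment) simp
        have j: "spider_cover {2} (leg_segment j 3 5)" by (rule spider_cover_segment) simp
        have k: "spider_cover {1} (leg_segment k 3 5)" by (rule spider_cover_segment) simp
        show ?thesis
          by (rule spider_cover_combine[OF c
                spider_cover_Un[OF i spider_cover_Un[OF j k]]])
            (auto simp: xyz 1 leg_segment_def)
      next
        case 2
        then have z8: "z = 8" using False x y z by auto
        have "spider_cover {1} (leg_segment k 5 7)" "spider_cover {0} (leg_segment k 8 8)"
          by (rule spider_cover_segment; simp)+
        then have "spider_cover {0, 1} (leg_segment k (m + 1) z)"
          by (rule spider_cover_combine) (auto simp: leg_segment_def 2 z8)
        from combine[OF Y this] 2 show ?thesis by auto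
      qed
    qed
  qed
qed

text \<open>
  By induction on \<open>m\<close>: as \<open>(m + 1) ^ 2 - m ^ 2 = 2 * m + 1\<close>, cutting \<open>2 * m + 1\<close> vertices off the end
  of a leg with the largest ball reduces \<open>m + 1\<close> to \<open>m\<close>.
\<close>

lemma spider_cover_three_legs:
  assumes "i \<noteq> j" and "i \<noteq> k" and "j \<noteq> k" and "x + y + z + 1 \<le> m ^ 2"
  shows "spider_cover {..<m} (leg_segment i 0 x \<union> leg_segment j 0 y \<union> leg_segment k 0 z)"
  using assms
proof (induction m arbitrary: i j k x y z)
  case 0
  then show ?case by simp
next
  case (Suc m)
  have long: "spider_cover {..<Suc m} (leg_segment i 0 x \<union> leg_segment j 0 y \<union> leg_segment k 0 z)"
    if d: "i \<noteq> j" "i \<noteq> k" "j \<noteq> k" and sum: "x + y + z + 1 \<le> (Suc m) ^ 2"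
      and x: "2 * m < x" for i j k x y z
  proof -
    have "spider_cover {m} (leg_segment i (x - 2 * m) x)"
      using x by (intro spider_cover_segment) auto
    moreover have "spider_cover {..<m}
        (leg_segment i 0 (x - (2 * m + 1)) \<union> leg_segment j 0 y \<union> leg_segment k 0 z)"
      using sum x by (intro Suc.IH d) (auto simp: power2_eq_square)
    ultimately show ?thesis
      by (rule spider_cover_combine) (auto simp: leg_segment_def)
  qed
  have sorted: "spider_cover {..<Suc m} (leg_segment i 0 x \<union> leg_segment j 0 y \<union> leg_segment k 0 z)"
    if d: "i \<noteq> j" "i \<noteq> k" "j \<noteq> k" and sum: "x + y + z + 1 \<le> (Suc m) ^ 2"
      and le: "y \<le> x" "z \<le> y" for i j k x y z
  proof -
    consider "2 * m < x" | "x \<le> 2 * m" "z = 0" | "x \<le> 2 * m" "1 \<le> z" by linarith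
    then show ?thesis
    proof cases
      case 1
      then show ?thesis using long d sum by blast
    next
      case 2
      then have "spider_cover {..<Suc m} (leg_segment i 0 x \<union> leg_segment j 0 y)"
        using d sum by (intro spider_cover_two_legs) auto
      then obtain c where c: "\<forall>p\<in>leg_segment i 0 x \<union> leg_segment j 0 y. \<exists>l\<in>{..<Suc m}. spider_dist (c l) p \<le> l"
        unfolding spider_cover_def by blast
      \<comment> \<open>The points \<open>(i, 0)\<close> and \<open>(k, 0)\<close> both stand for the centre.\<close>
      have "spider_dist q (k, 0) = spider_dist q (i, 0)" for q
        by (auto simp: spider_dist_def)
      moreover have "(i, 0) \<in> leg_segment i 0 x" by (auto simp: leg_segment_def)
      ultimately have "\<exists>l\<in>{..<Suc m}. spider_dist (c l) (k, 0) \<le> l"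
        using c by (metis UnI1)
      then show ?thesis
        using c 2 unfolding spider_cover_def by (intro exI[of _ c]) (auto simp: leg_segment_def)
    next
      case 3
      then show ?thesis using d sum le by (intro spider_cover_short_legs) auto
    qed
  qed
  consider "y \<le> x \<and> z \<le> y" | "z \<le> x \<and> y \<le> z" | "x \<le> y \<and> z \<le> x" | "z \<le> y \<and> x \<le> z"
    | "x \<le> z \<and> y \<le> x" | "y \<le> z \<and> x \<le> y" by linarith
  then show ?case
    by cases
      (use Suc.prems sorted[of i j k x y z] sorted[of i k j x z y] sorted[of j i k y x z]
        sorted[of j k i y z x] sorted[of k i j z x y] sorted[of k j i z y x]
       in \<open>auto simp: ac_simps\<close>)
qed

section \<open>The upper bound\<close>

text \<open>
  Deleting the edge between \<open>Cyc (g - 1)\<close> and \<open>Cyc g\<close> leaves a spanning spider with centre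
  \<open>Cyc g\<close>, whose leg 0 is the rest of the cycle.  A missing path is a leg of length 0.
\<close>

definition spider_vertex :: "nat \<Rightarrow> nat \<times> nat \<Rightarrow> uvertex" where
  "spider_vertex g p =
     (if snd p = 0 then Cyc g else if fst p = 0 then Cyc (snd p) else Leg (fst p - 1) (snd p))"

definition leg_length :: "nat \<Rightarrow> nat list \<Rightarrow> nat \<Rightarrow> nat" where
  "leg_length g as i = (if i = 0 then g - 1 else if i \<le> length as then as ! (i - 1) else 0)"

lemma spider_vertex_adj:
  assumes g: "3 \<le> g" and j: "j < leg_length g as i"
  shows "spider_vertex g (i, j) \<rightarrow>\<^bsub>cycle_with_paths g as\<^esub> spider_vertex g (i, Suc j)"
    and "spider_vertex g (i, Suc j) \<rightarrow>\<^bsub>cycle_with_paths g as\<^esub> spider_vertex g (i, j)"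
  using assms
  by (auto simp: spider_vertex_def leg_length_def cycle_with_paths_def Let_def split: if_splits)

lemma spider_vertex_in_ball_leg:
  assumes g: "3 \<le> g" and b: "b \<le> leg_length g as i" and ab: "a \<le> b"
  shows "spider_vertex g (i, b) \<in> graph_ball (cycle_with_paths g as) (b - a) (spider_vertex g (i, a))"
    and "spider_vertex g (i, a) \<in> graph_ball (cycle_with_paths g as) (b - a) (spider_vertex g (i, b))"
  using ab b
proof (induction b rule: dec_induct)
  case base
  { case 1 show ?case by (rule graph_ball_self) }
  { case 2 show ?case by (rule graph_ball_self) }
next
  case (step b)
  let ?G = "cycle_with_paths g as"
  have e: "b - a + 1 = Suc b - a" "1 + (b - a) = Suc b - a" using step.hyps by auto
  { case 1
    then have b: "b < leg_length g as i" by simp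
    have "spider_vertex g (i, Suc b) \<in> graph_ball ?G (b - a + 1) (spider_vertex g (i, a))"
      using b by (intro graph_ball_trans[OF step.IH(1)] graph_ball_adj spider_vertex_adj(1)[OF g]) auto
    then show ?case by (simp only: e) }
  { case 2
    then have b: "b < leg_length g as i" by simp
    have "spider_vertex g (i, a) \<in> graph_ball ?G (1 + (b - a)) (spider_vertex g (i, Suc b))"
      using b by (intro graph_ball_trans[OF graph_ball_adj step.IH(2)] spider_vertex_adj(2)[OF g]) auto
    then show ?case by (simp only: e) }
qed

lemma spider_vertex_in_ball:
  assumes g: "3 \<le> g" and a: "a \<le> leg_length g as i" and b: "b \<le> leg_length g as j"
  shows "spider_vertex g (j, b)
    \<in> graph_ball (cycle_with_paths g as) (spider_dist (i, a) (j, b)) (spider_vertex g (i, a))"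
proof (cases "i = j")
  case True
  show ?thesis
  proof (cases "a \<le> b")
    case le: True
    then have "spider_dist (i, a) (j, b) = b - a" by (simp add: spider_dist_def True)
    then show ?thesis using spider_vertex_in_ball_leg(1)[OF g b le] True by simp
  next
    case False
    then have "spider_dist (i, a) (j, b) = a - b" by (simp add: spider_dist_def True)
    then show ?thesis using spider_vertex_in_ball_leg(2)[OF g a, of b] False True by simp
  qed
next
  case False
  have "spider_vertex g (j, 0) = spider_vertex g (i, 0)" by (simp add: spider_vertex_def)
  then show ?thesis
    using graph_ball_trans[OF spider_vertex_in_ball_leg(2)[OF g a, of 0]]
      spider_vertex_in_ball_leg(1)[OF g b, of 0] False
    by (simp add: spider_dist_def)
qed

lemma spider_vertex_in_verts:
  assumes "3 \<le> g" and "a \<le> leg_length g as i"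
  shows "spider_vertex g (i, a) \<in> pverts (cycle_with_paths g as)"
  using assms
  by (auto simp: spider_vertex_def leg_length_def cycle_with_paths_def Let_def split: if_splits)

lemma spider_vertex_surj:
  assumes "v \<in> pverts (cycle_with_paths g as)"
  obtains i a where "i \<le> length as" and "a \<le> leg_length g as i" and "v = spider_vertex g (i, a)"
proof -
  consider "v = Cyc g" | i where "v = Cyc i" "1 \<le> i" "i < g"
    | i j where "v = Leg i j" "i < length as" "1 \<le> j" "j \<le> as ! i"
    using assms by (fastforce simp: cycle_with_paths_def Let_def)
  then show ?thesis
  proof cases
    case 1
    show ?thesis by (rule that[of 0 0]) (auto simp: 1 spider_vertex_def)
  next
    case (2 i)
    then show ?thesis by (intro that[of 0 i]) (auto simp: spider_vertex_def leg_length_def)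
  next
    case (3 i j)
    then show ?thesis
      by (intro that[of "Suc i" j]) (auto simp: spider_vertex_def leg_length_def)
  qed
qed

lemma burning_number_cycle_with_paths_le:
  assumes g: "3 \<le> g" and pos: "\<forall>a \<in> set as. a \<ge> 1" and len: "length as \<le> 2"
    and n: "g + sum_list as \<le> m ^ 2"
  shows "burning_number (cycle_with_paths g as) \<le> m"
proof -
  interpret pair_graph "cycle_with_paths g as"
    using pair_graph_cycle_with_paths g pos by blast
  let ?G = "cycle_with_paths g as" and ?l = "leg_length g as"
  have "?l 0 + ?l 1 + ?l 2 + 1 = g + sum_list as"
  proof -
    consider "as = []" | a where "as = [a]" | a b where "as = [a, b]"
      using len by (auto simp: le_Suc_eq numeral_2_eq_2 length_Suc_conv)
    then show ?thesis using g by cases (auto simp: leg_length_def)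
  qed
  then have "spider_cover {..<m} (leg_segment 0 0 (?l 0) \<union> leg_segment 1 0 (?l 1) \<union> leg_segment 2 0 (?l 2))"
    using n by (intro spider_cover_three_legs) auto
  moreover have "(i, a) \<in> leg_segment 0 0 (?l 0) \<union> leg_segment 1 0 (?l 1) \<union> leg_segment 2 0 (?l 2)"
    if "i \<le> length as" "a \<le> ?l i" for i a
    using that len by (auto simp: leg_segment_def le_Suc_eq numeral_2_eq_2)
  ultimately obtain c where c: "\<And>i a. i \<le> length as \<Longrightarrow> a \<le> ?l i \<Longrightarrow>
      \<exists>k<m. spider_dist (c k) (i, a) \<le> k"
    unfolding spider_cover_def by blast
  \<comment> \<open>Moving a centre from beyond the end of a leg to that end takes it away from no vertex of the graph.\<close>
  define d where "d k = (fst (c k), min (snd (c k)) (?l (fst (c k))))" for k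
  have d: "spider_dist (d k) (i, a) \<le> spider_dist (c k) (i, a)" if "a \<le> ?l i" for k i a
    using that by (auto simp: d_def spider_dist_def)
  have "pverts ?G \<subseteq> (\<Union>k<m. graph_ball ?G k (spider_vertex g (d k)))"
  proof
    fix v assume "v \<in> pverts ?G"
    then obtain i a where i: "i \<le> length as" and a: "a \<le> ?l i" and v: "v = spider_vertex g (i, a)"
      by (rule spider_vertex_surj)
    obtain k where k: "k < m" "spider_dist (d k) (i, a) \<le> k"
      using c[OF i a] d[OF a] le_trans by blast
    have "v \<in> graph_ball ?G (spider_dist (d k) (i, a)) (spider_vertex g (d k))"
      unfolding v d_def by (rule spider_vertex_in_ball[OF g _ a]) simp
    then have "v \<in> graph_ball ?G k (spider_vertex g (d k))"
      using graph_ball_mono[OF k(2), of ?G "spider_vertex g (d k)"] by auto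
    then show "v \<in> (\<Union>k<m. graph_ball ?G k (spider_vertex g (d k)))"
      using k(1) by blast
  qed
  moreover have "\<forall>k<m. spider_vertex g (d k) \<in> pverts ?G"
    unfolding d_def using spider_vertex_in_verts[OF g] by auto
  moreover have "pverts ?G \<noteq> {}"
    using spider_vertex_in_verts[OF g] by blast
  ultimately show ?thesis
    by (subst burning_number_le_iff) (auto intro!: exI[of _ "\<lambda>k. spider_vertex g (d k)"])
qed

section \<open>The lower bound\<close>

fun on_cycle :: "uvertex \<Rightarrow> bool" where
  "on_cycle (Cyc i) = True"
| "on_cycle (Leg i j) = False"

text \<open>The distance from the junction \<open>Cyc g\<close>.\<close>

fun height :: "nat \<Rightarrow> uvertex \<Rightarrow> int" where
  "height g (Cyc i) = min (int i) (int g - int i)"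
| "height g (Leg i j) = int j"

text \<open>
  The two attached paths are laid out on a line, with the cycle at coordinate 0.  A walk between two
  paths passes through \<open>Cyc g\<close> and is thus at least as long as the difference of the coordinates.
\<close>

fun leg_coord :: "uvertex \<Rightarrow> int" where
  "leg_coord (Cyc i) = 0"
| "leg_coord (Leg i j) = (if i = 0 then int j else - int j)"

text \<open>
  With at most two attached paths this is the distance in the graph, but it is used as a lower bound
  for the lengths of walks: it vanishes on the diagonal and changes by at most 1 along an edge.
\<close>

fun walk_bound :: "nat \<Rightarrow> uvertex \<Rightarrow> uvertex \<Rightarrow> int" where
  "walk_bound g (Cyc i) (Cyc j) = min \<bar>int i - int j\<bar> (int g - \<bar>int i - int j\<bar>)"
| "walk_bound g (Leg i j) (Leg k l) = \<bar>leg_coord (Leg i j) - leg_coord (Leg k l)\<bar>"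
| "walk_bound g x y = height g x + height g y"

lemma pverts_cycle_with_paths_cases:
  assumes "v \<in> pverts (cycle_with_paths g as)"
  obtains i where "v = Cyc i" and "1 \<le> i" and "i \<le> g"
  | i j where "v = Leg i j" and "i < length as" and "1 \<le> j" and "j \<le> as ! i"
  using assms by (auto simp: cycle_with_paths_def Let_def)

lemma height_nonneg: "v \<in> pverts (cycle_with_paths g as) \<Longrightarrow> 0 \<le> height g v"
  by (erule pverts_cycle_with_paths_cases) auto

lemma walk_bound_self: "walk_bound g x x = 0"
  by (cases x) auto

lemma cyclic_distance_step:
  fixes a g :: int
  shows "\<bar>min \<bar>a\<bar> (g - \<bar>a\<bar>) - min \<bar>a - 1\<bar> (g - \<bar>a - 1\<bar>)\<bar> \<le> 1"
proof -
  have lipschitz: "\<bar>min b (g - b) - min c (g - c)\<bar> \<le> 1" if "\<bar>b - c\<bar> \<le> 1" for b c :: int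
    using that by linarith
  show ?thesis by (rule lipschitz) linarith
qed

lemma walk_bound_adj:
  assumes x: "x \<in> pverts (cycle_with_paths g as)"
    and yz: "(y, z) \<in> parcs (cycle_with_paths g as)"
  shows "walk_bound g x z \<le> walk_bound g x y + 1"
proof -
  define E where "E = {(Cyc i, Cyc (Suc i)) | i. 1 \<le> i \<and> i < g} \<union> {(Cyc g, Cyc 1)}
            \<union> {(Cyc g, Leg i 1) | i. i < length as}
            \<union> {(Leg i j, Leg i (Suc j)) | i j. i < length as \<and> 1 \<le> j \<and> j < as ! i}"
  have "\<bar>walk_bound g x u - walk_bound g x v\<bar> \<le> 1" if "(u, v) \<in> E" for u v
  proof -
    consider i where "u = Cyc i" "v = Cyc (Suc i)" "1 \<le> i" "i < g" | "u = Cyc g" "v = Cyc 1"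
      | i where "u = Cyc g" "v = Leg i 1" | i j where "u = Leg i j" "v = Leg i (Suc j)"
      using \<open>(u, v) \<in> E\<close> unfolding E_def by blast
    then show ?thesis
    proof cases
      case (1 i)
      show ?thesis
        using x
      proof (cases rule: pverts_cycle_with_paths_cases)
        case (1 c)
        then show ?thesis
          using cyclic_distance_step[of "int c - int i" "int g"] \<open>u = Cyc i\<close> \<open>v = Cyc (Suc i)\<close>
          by (simp add: algebra_simps)
      qed (use 1 in auto)
    qed (use x in \<open>auto elim!: pverts_cycle_with_paths_cases\<close>)
  qed
  from this[of y z] this[of z y] yz show ?thesis
    unfolding cycle_with_paths_def Let_def E_def[symmetric] by auto
qed

lemma walk_bound_graph_ball:
  assumes x: "x \<in> pverts (cycle_with_paths g as)"
    and y: "y \<in> graph_ball (cycle_with_paths g as) k x"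
  shows "walk_bound g x y \<le> int k"
proof -
  have "walk_bound g x z \<le> int l" if "(x, z) \<in> parcs (cycle_with_paths g as) ^^ l" for z l
    using that
  proof (induction l arbitrary: z)
    case 0
    then show ?case by (simp add: walk_bound_self)
  next
    case (Suc l)
    then obtain w where "(x, w) \<in> parcs (cycle_with_paths g as) ^^ l"
      and w: "(w, z) \<in> parcs (cycle_with_paths g as)" by auto
    then show ?case using Suc.IH[of w] walk_bound_adj[OF x w] by simp
  qed
  then show ?thesis using y by (force simp: graph_ball_def)
qed

lemma walk_bound_le_heights:
  assumes "x \<in> pverts (cycle_with_paths g as)" and "y \<in> pverts (cycle_with_paths g as)"
  shows "walk_bound g x y \<le> height g x + height g y"
  using assms by (elim pverts_cycle_with_paths_cases) auto

lemma walk_bound_other_part: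
  "on_cycle x \<noteq> on_cycle y \<Longrightarrow> walk_bound g x y = height g x + height g y"
  by (cases x; cases y) auto

text \<open>The offset \<open>s\<close> unrolls the cycle around \<open>Cyc c\<close>; it is injective since it determines \<open>j\<close> modulo \<open>g\<close>.\<close>

lemma card_cyclic_ball:
  assumes "1 \<le> c" and "c \<le> g"
  shows "card {v \<in> pverts (cycle_with_paths g as).
    on_cycle v \<and> walk_bound g (Cyc c) v \<le> int k} \<le> 2 * k + 1"
    (is "card ?A \<le> _")
proof -
  define s where "s j = (if \<bar>int j - int c\<bar> \<le> int k then int j - int c
     else if c < j then int j - int c - int g else int j - int c + int g)" for j
  let ?J = "{j. 1 \<le> j \<and> j \<le> g \<and> walk_bound g (Cyc c) (Cyc j) \<le> int k}"
  have "card ?A \<le> card (Cyc ` ?J)"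
    by (intro card_mono) (auto elim!: pverts_cycle_with_paths_cases)
  also have "\<dots> \<le> card ?J"
    by (intro card_image_le) auto
  also have "\<dots> \<le> card {- int k..int k}"
  proof (rule card_inj_on_le[of s])
    show "inj_on s ?J"
      by (rule inj_onI) (auto simp: s_def split: if_splits)
    show "s ` ?J \<subseteq> {- int k..int k}"
      using assms by (auto simp: s_def)
  qed simp
  also have "\<dots> = 2 * k + 1" by simp
  finally show ?thesis .
qed

lemma card_leg_ball:
  assumes len: "length as \<le> 2"
  shows "card {v \<in> pverts (cycle_with_paths g as).
    \<not> on_cycle v \<and> \<bar>a - leg_coord v\<bar> \<le> int k} \<le> 2 * k + 1"
    (is "card ?A \<le> _")
proof -
  have "card ?A \<le> card {a - int k..a + int k}"
  proof (rule card_inj_on_le[of leg_coord])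
    show "inj_on leg_coord ?A"
      using len
      by (intro inj_onI) (auto elim!: pverts_cycle_with_paths_cases split: if_splits)
    show "leg_coord ` ?A \<subseteq> {a - int k..a + int k}" by auto
  qed simp
  then show ?thesis by simp
qed

lemma card_own_part_ball:
  assumes len: "length as \<le> 2" and x: "x \<in> pverts (cycle_with_paths g as)"
  shows "card {v \<in> pverts (cycle_with_paths g as).
    on_cycle v = on_cycle x \<and> walk_bound g x v \<le> int k} \<le> 2 * k + 1"
    (is "card ?A \<le> _")
  using x
proof (cases rule: pverts_cycle_with_paths_cases)
  case (1 c)
  then show ?thesis using card_cyclic_ball[of c g as k] by simp
next
  case (2 i j)
  then have "?A = {v \<in> pverts (cycle_with_paths g as).
      \<not> on_cycle v \<and> \<bar>leg_coord x - leg_coord v\<bar> \<le> int k}"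
  proof (intro Collect_cong conj_cong[OF refl])
    show "(on_cycle v = on_cycle x \<and> walk_bound g x v \<le> int k)
        = (\<not> on_cycle v \<and> \<bar>leg_coord x - leg_coord v\<bar> \<le> int k)" for v
      using 2(1) by (cases v) auto
  qed
  then show ?thesis using card_leg_ball[OF len, of g "leg_coord x" k] by simp
qed

lemma card_low_part:
  assumes g: "1 \<le> g" and len: "length as \<le> 2"
  shows "card {v \<in> pverts (cycle_with_paths g as). on_cycle v = b \<and> height g v \<le> int k}
    \<le> 2 * k + 1"
    (is "card ?A \<le> _")
proof (cases b)
  case True
  then have "?A = {v \<in> pverts (cycle_with_paths g as). on_cycle v \<and> walk_bound g (Cyc g) v \<le> int k}"
    by (intro Collect_cong conj_cong[OF refl]) (auto elim!: pverts_cycle_with_paths_cases split: if_splits)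
  then show ?thesis using card_cyclic_ball[of g g as k] g by simp
next
  case False
  then have "?A = {v \<in> pverts (cycle_with_paths g as). \<not> on_cycle v \<and> \<bar>0 - leg_coord v\<bar> \<le> int k}"
    by (intro Collect_cong conj_cong[OF refl]) (auto elim!: pverts_cycle_with_paths_cases split: if_splits)
  then show ?thesis using card_leg_ball[OF len, of g 0 k] by simp
qed

text \<open>
  Call the cycle and the union of the attached paths the two parts of the graph.  A ball of radius
  \<open>k\<close> has at most \<open>2 * k + 1\<close> vertices in the part of its centre, which sums to \<open>b ^ 2\<close>.  In the
  other part it consists of the vertices up to some height, its reach \<open>R k\<close>.  Let \<open>c s\<close> be the
  centre with the largest reach.  What any ball covers across the junction
  has height at most \<open>R s\<close>, so in the part of \<open>c s\<close> it is already covered from \<open>c s\<close>, and the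
  excess lies in a single set \<open>F\<close> of at most \<open>2 * b - 1\<close> vertices.
\<close>

lemma card_covered_cycle_with_paths_le:
  assumes g: "1 \<le> g" and len: "length as \<le> 2"
    and c: "\<And>k. k < b \<Longrightarrow> c k \<in> pverts (cycle_with_paths g as)"
    and cov: "pverts (cycle_with_paths g as)
      \<subseteq> (\<Union>k<b. graph_ball (cycle_with_paths g as) k (c k))"
  shows "g + sum_list as \<le> b ^ 2 + 2 * b"
proof (cases "b = 0")
  case True
  then have "pverts (cycle_with_paths g as) = {}" using cov by auto
  then show ?thesis using card_cycle_with_paths[of g as] g by simp
next
  case False
  let ?V = "pverts (cycle_with_paths g as)"
  have fin: "finite ?V"
    using card_cycle_with_paths[of g as] g by (intro card_ge_0_finite) simp
  define R where "R k = int k - height g (c k)" for k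
  define Own where "Own k = {v \<in> ?V. on_cycle v = on_cycle (c k) \<and> walk_bound g (c k) v \<le> int k}" for k
  have "Max (R ` {..<b}) \<in> R ` {..<b}"
    using False by (intro Max_in) auto
  then obtain s where s: "s < b" and R_max: "R s = Max (R ` {..<b})" by auto
  have max: "R k \<le> R s" if "k < b" for k
    unfolding R_max using that by (intro Max_ge) auto
  have Rs: "R s \<le> int (b - 1)"
    using height_nonneg[OF c[OF s]] s by (simp add: R_def)
  define F where "F = {v \<in> ?V. on_cycle v = (\<not> on_cycle (c s)) \<and> height g v \<le> int (b - 1)}"
  have "v \<in> (\<Union>k<b. Own k) \<union> F" if v: "v \<in> ?V" for v
  proof -
    obtain k where k: "k < b" and "v \<in> graph_ball (cycle_with_paths g as) k (c k)"
      using cov v by auto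
    then have vk: "walk_bound g (c k) v \<le> int k"
      using walk_bound_graph_ball c by blast
    show ?thesis
    proof (cases "on_cycle v = on_cycle (c k)")
      case True
      then show ?thesis using v vk k by (auto simp: Own_def)
    next
      case False
      then have "height g v \<le> R k"
        using vk walk_bound_other_part[of "c k" v g] by (auto simp: R_def)
      then have h: "height g v \<le> R s" using max[OF k] by simp
      show ?thesis
      proof (cases "on_cycle v = on_cycle (c s)")
        case True
        have "walk_bound g (c s) v \<le> int s"
          using walk_bound_le_heights[OF c[OF s] v] h by (simp add: R_def)
        then show ?thesis using True v s by (auto simp: Own_def)
      next
        case False
        then show ?thesis using h Rs v by (auto simp: F_def)
      qed
    qed
  qed
  then have "card ?V \<le> card ((\<Union>k<b. Own k) \<union> F)"
    using fin by (intro card_mono) (auto simp: Own_def F_def)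
  also have "\<dots> \<le> card (\<Union>k<b. Own k) + card F"
    by (rule card_Un_le)
  also have "card (\<Union>k<b. Own k) \<le> (\<Sum>k<b. card (Own k))"
    by (intro card_UN_le) simp
  also have "(\<Sum>k<b. card (Own k)) \<le> (\<Sum>k<b. 2 * k + 1)"
    unfolding Own_def using c card_own_part_ball[OF len] by (intro sum_mono) auto
  also have "(\<Sum>k<b. 2 * k + 1) = b ^ 2"
    by (induction b) (auto simp: power2_eq_square)
  also have "card F \<le> 2 * (b - 1) + 1"
    unfolding F_def by (rule card_low_part[OF g len])
  finally show ?thesis using False by (simp add: card_cycle_with_paths)
qed

lemma order_cycle_with_paths_le:
  assumes g: "3 \<le> g" and pos: "\<forall>a \<in> set as. a \<ge> 1" and len: "length as \<le> 2"
    and b: "burning_number (cycle_with_paths g as) \<le> b"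
  shows "g + sum_list as \<le> b ^ 2 + 2 * b"
proof -
  interpret pair_graph "cycle_with_paths g as"
    using pair_graph_cycle_with_paths g pos by blast
  have "pverts (cycle_with_paths g as) \<noteq> {}"
    using card_cycle_with_paths[of g as] g by auto
  then obtain c where "\<And>k. k < b \<Longrightarrow> c k \<in> pverts (cycle_with_paths g as)"
    and "pverts (cycle_with_paths g as)
      \<subseteq> (\<Union>k<b. graph_ball (cycle_with_paths g as) k (c k))"
    using burning_number_le_iff[of b] b by auto
  then show ?thesis
    using g by (intro card_covered_cycle_with_paths_le[OF _ len]) auto
qed

section \<open>Bounds for the burning number\<close>

theorem corollary2p7:
  fixes g t n q r :: nat and G :: "('a, 'b) pre_digraph"
  assumes "g \<ge> 3"
    and "1 \<le> t" and "t \<le> 2"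
    and "g + t \<le> n"
    and "G \<in> unicyclic_class n g t"
    and "q \<ge> 1"
    and "1 \<le> r" and "r \<le> 2 * q + 1"
    and "n = q ^ 2 + r"
  shows "q \<le> burning_number G \<and> burning_number G \<le> q + 1"
proof -
  obtain as where len: "length as = t" and pos: "\<forall>a \<in> set as. a \<ge> 1" and n: "n = g + sum_list as"
    and iso: "digraph_iso (with_proj (cycle_with_paths g as)) G"
    using assms(5) by (auto simp: unicyclic_class_def)
  interpret H: pair_graph "cycle_with_paths g as"
    using pair_graph_cycle_with_paths assms(1) pos by blast
  have "pverts (cycle_with_paths g as) \<noteq> {}"
    using card_cycle_with_paths[of g as] assms(1) by auto
  then have eq: "burning_number G = burning_number (cycle_with_paths g as)"
    using iso H.fin_digraph_axioms by (intro burning_number_iso) auto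
  have len2: "length as \<le> 2" using len assms(3) by simp
  have "g + sum_list as \<le> (q + 1) ^ 2"
    using n assms(8,9) by (simp add: power2_eq_square)
  then have upper: "burning_number G \<le> q + 1"
    unfolding eq by (rule burning_number_cycle_with_paths_le[OF assms(1) pos len2])
  let ?b = "burning_number G"
  have "n \<le> ?b ^ 2 + 2 * ?b"
    unfolding n by (rule order_cycle_with_paths_le[OF assms(1) pos len2]) (simp add: eq)
  also have "\<dots> < (?b + 1) ^ 2" by (simp add: power2_eq_square)
  finally have "q ^ 2 < (?b + 1) ^ 2" using assms(7,9) by simp
  then have "q < ?b + 1" by (rule power_less_imp_less_base) simp
  then show ?thesis using upper by simp
qed

end
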